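(* Let $b\in\{0,2,4,\ldots\}$ and let $k,m$ be positive integers. Then $$E_{2^mk+b}-E_b\equiv \begin{cases} 2k\bigl(-(b-7)^2+38+2k(3b-1+2k)\bigr)\pmod{2^{m+7}} & \text{if } m=1 \text{ and } 2\mid k,\\[2pt] 2k\bigl(-(b+1)^2+6+2k(3b-1+2k)\bigr)-16\bigl(b+(-1)^{b/2}\bigr)\pmod{2^{m+7}} & \text{if } m=1 \text{ and } 2\nmid k,\\[2pt] 4k\Bigl(7(b+1)^2-18+12k\bigl(b+1+4((-1)^{b/2}-k)\bigr)\Bigr)\pmod{2^{m+7}} & \text{if } m=2,\\[2pt] 2^mk\bigl(7(b+1)^2-18+2^mk(7-b)\bigr)\pmod{2^{m+7}} & \text{if } m\ge 3.\end{cases}$$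
   Context: The Euler numbers $\{E_n\}_{n\ge 0}$ are defined by $E_0=1$, $E_{2n-1}=0$ and $\sum_{r=0}^{n}\binom{2n}{2r}E_{2r}=0$ for $n=1,2,3,\ldots$. (E.g. $E_2=-1$, $E_4=5$, $E_6=-61$, $E_8=1385$.) *)

theory Defs
  imports "HOL-Number_Theory.Number_Theory"
begin

text \<open>
  The second clause solves the defining relation
  \<open>\<Sum>r\<le>n. (2 n choose 2 r) E (2 r) = 0\<close> (for \<open>n > 0\<close>) for its last summand, whose coefficient
  is 1; \<open>euler_number_sum\<close> and \<open>euler_number_unique\<close> below confirm that this is the same sequence.
\<close>
function euler_number :: "nat \<Rightarrow> int" where
  "euler_number n =
    (if n = 0 then 1
     else if odd n then 0
     else - (\<Sum>r<n div 2. int (n choose (2 * r)) * euler_number (2 * r)))"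
  by auto
termination
  by (relation "measure id") auto

declare euler_number.simps [simp del]

lemma euler_number_0: "euler_number 0 = 1"
  by (simp add: euler_number.simps)

lemma euler_number_odd: "n \<ge> 1 \<Longrightarrow> euler_number (2 * n - 1) = 0"
  by (subst euler_number.simps) auto

lemma euler_number_sum:
  assumes "n \<ge> 1"
  shows "(\<Sum>r\<le>n. int ((2 * n) choose (2 * r)) * euler_number (2 * r)) = 0"
proof -
  have "euler_number (2 * n) =
      - (\<Sum>r<n. int ((2 * n) choose (2 * r)) * euler_number (2 * r))"
    using assms by (subst euler_number.simps) simp
  then show ?thesis
    by (simp add: lessThan_Suc_atMost [symmetric])
qed

lemma euler_number_unique:
  fixes e :: "nat \<Rightarrow> int"
  assumes "e 0 = 1"
    and odd: "\<And>n. n \<ge> 1 \<Longrightarrow> e (2 * n - 1) = 0"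
    and sum: "\<And>n. n \<ge> 1 \<Longrightarrow> (\<Sum>r\<le>n. int ((2 * n) choose (2 * r)) * e (2 * r)) = 0"
  shows "e = euler_number"
proof
  fix n
  show "e n = euler_number n"
  proof (induction n rule: less_induct)
    case (less n)
    consider "n = 0" | l where "n = 2 * l - 1" "l \<ge> 1" | l where "n = 2 * l" "l \<ge> 1"
    proof (cases "even n")
      case True
      then obtain l where "n = 2 * l" by (elim evenE)
      then show ?thesis using that(1) that(3)[of l] by (cases "l = 0") auto
    next
      case False
      then obtain l where "n = 2 * l + 1" by (elim oddE)
      then show ?thesis using that(2)[of "Suc l"] by auto
    qed
    then show ?case
    proof cases
      case 1
      then show ?thesis using assms(1) euler_number_0 by simp
    next
      case 2
      then show ?thesis using odd euler_number_odd by simp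
    next
      case 3
      have "(\<Sum>r<l. int ((2 * l) choose (2 * r)) * e (2 * r)) =
          (\<Sum>r<l. int ((2 * l) choose (2 * r)) * euler_number (2 * r))"
        using less 3 by (intro sum.cong) auto
      moreover have "(\<Sum>r<l. int ((2 * l) choose (2 * r)) * e (2 * r)) + e (2 * l) = 0"
        using sum[OF 3(2)] by (simp add: lessThan_Suc_atMost [symmetric])
      moreover have "(\<Sum>r<l. int ((2 * l) choose (2 * r)) * euler_number (2 * r))
          + euler_number (2 * l) = 0"
        using euler_number_sum[OF 3(2)] by (simp add: lessThan_Suc_atMost [symmetric])
      ultimately show ?thesis using 3 by simp
    qed
  qed
qed

end

theory Submission
  imports Defs "HOL-Computational_Algebra.Polynomial"
begin

text \<open>
  Let \<open>L\<close> be the linear functional on integer polynomials with \<open>L (x ^ n) = E n\<close>. The defining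
  relation of the Euler numbers says \<open>L (p (x + 1) + p (x - 1)) = 2 p(0)\<close>, which gives
  \<open>L ((x - 1) (x - 3) \<cdots> (x - (2 j - 1))) = (-1)\<^sup>j j!\<close>. Expanding \<open>(x\<^sup>2 - 1) ^ t\<close> in these products shows
  that \<open>D t = L ((x\<^sup>2 - 1) ^ t)\<close>, the \<open>t\<close>-th difference of \<open>n \<mapsto> E (2 n)\<close> at \<open>0\<close>, is divisible by
  \<open>2 ^ (t + t div 2)\<close>. Hence in \<open>E (2 n) = (\<Sum>t. (n choose t) D t)\<close> only the terms with \<open>t \<le> 5\<close>
  contribute to \<open>E (2 (N + K)) - E (2 N)\<close> modulo \<open>2\<^sup>8\<close> times the power of \<open>2\<close> in \<open>K\<close>, and what remains
  is an explicit polynomial in \<open>N\<close> and \<open>K\<close>, divisible by \<open>K\<close>.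
\<close>

section \<open>The linear functional whose moments are the Euler numbers\<close>

definition euler_functional :: "int poly \<Rightarrow> int" where
  "euler_functional p = (\<Sum>i\<le>degree p. coeff p i * euler_number i)"

lemma euler_functional_eq:
  assumes "degree p \<le> n"
  shows "euler_functional p = (\<Sum>i\<le>n. coeff p i * euler_number i)"
  unfolding euler_functional_def using assms
  by (intro sum.mono_neutral_left) (auto simp: coeff_eq_0)

lemma euler_functional_add:
  "euler_functional (p + q) = euler_functional p + euler_functional q"
proof -
  let ?n = "max (degree p) (degree q)"
  have "euler_functional (p + q) = (\<Sum>i\<le>?n. coeff (p + q) i * euler_number i)"
    by (intro euler_functional_eq) (rule degree_add_le_max)
  also have "\<dots> = euler_functional p + euler_functional q"
    by (simp add: euler_functional_eq[of p ?n] euler_functional_eq[of q ?n]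
        sum.distrib distrib_right)
  finally show ?thesis .
qed

lemma euler_functional_smult: "euler_functional (smult c p) = c * euler_functional p"
proof -
  have "euler_functional (smult c p) = (\<Sum>i\<le>degree p. coeff (smult c p) i * euler_number i)"
    by (intro euler_functional_eq) (rule degree_smult_le)
  then show ?thesis
    by (simp add: euler_functional_def sum_distrib_left mult.assoc)
qed

lemma euler_functional_0 [simp]: "euler_functional 0 = 0"
  by (simp add: euler_functional_def)

lemma euler_functional_sum:
  "euler_functional (\<Sum>i\<in>A. f i) = (\<Sum>i\<in>A. euler_functional (f i))"
  by (induction A rule: infinite_finite_induct) (simp_all add: euler_functional_add)

lemma euler_functional_monom: "euler_functional (monom 1 n) = euler_number n"
proof -
  have "euler_functional (monom 1 n) = (\<Sum>i\<le>n. coeff (monom 1 n) i * euler_number i)"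
    by (intro euler_functional_eq) (rule degree_monom_le)
  then show ?thesis by (simp add: if_distrib[of "\<lambda>x. x * _"] cong: if_cong)
qed

lemma euler_functional_linear_power:
  "euler_functional ([:c, 1:] ^ n) = (\<Sum>i\<le>n. int (n choose i) * c ^ (n - i) * euler_number i)"
  by (subst euler_functional_eq[of _ n])
    (simp_all add: degree_linear_power coeff_linear_poly_power)

lemma euler_number_eq_0_if_odd: "odd n \<Longrightarrow> euler_number n = 0"
  by (subst euler_number.simps) (auto simp: odd_pos)

text \<open>If \<open>n\<close> is odd, the two signs cancel at even \<open>i\<close>, and the Euler
  number vanishes at odd \<open>i\<close>. If \<open>n\<close> is even, only even \<open>i\<close>
  survive and the signs agree there, which leaves twice the defining sum.\<close>

lemma euler_functional_shift_power:
  "euler_functional ([:1, 1:] ^ n) + euler_functional ([:-1, 1:] ^ n) = (if n = 0 then 2 else 0)"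
proof (cases "even n")
  case False
  have "int (n choose i) * 1 ^ (n - i) * euler_number i +
      int (n choose i) * (-1) ^ (n - i) * euler_number i = 0" if "i \<le> n" for i
    using that False by (cases "even i") (simp_all add: euler_number_eq_0_if_odd)
  then show ?thesis
    using False unfolding euler_functional_linear_power sum.distrib[symmetric]
    by (cases "n = 0") (simp_all add: sum.neutral)
next
  case True
  then obtain l where l: "n = 2 * l" by (elim evenE)
  define g where "g i = int (n choose i) * 1 ^ (n - i) * euler_number i +
      int (n choose i) * (-1) ^ (n - i) * euler_number i" for i
  have "(\<Sum>i\<le>2 * l. g i) = (\<Sum>i\<in>(\<lambda>r. 2 * r) ` {..l}. g i)"
  proof (intro sum.mono_neutral_right ballI)
    fix i assume i: "i \<in> {..2 * l} - (\<lambda>r. 2 * r) ` {..l}"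
    have "odd i"
    proof
      assume "even i"
      then obtain r where "i = 2 * r" by (elim evenE)
      with i show False by auto
    qed
    then show "g i = 0" by (simp add: g_def euler_number_eq_0_if_odd)
  qed auto
  also have "\<dots> = (\<Sum>r\<le>l. g (2 * r))"
    by (subst sum.reindex) (simp_all add: inj_on_def)
  also have "\<dots> = (\<Sum>r\<le>l. 2 * (int (2 * l choose (2 * r)) * euler_number (2 * r)))"
    by (intro sum.cong) (simp_all add: g_def l flip: diff_mult_distrib2)
  also have "\<dots> = (if n = 0 then 2 else 0)"
    using euler_number_sum[of l] l
    by (cases "l = 0") (simp_all add: euler_number_0 flip: sum_distrib_left)
  finally show ?thesis
    unfolding euler_functional_linear_power sum.distrib[symmetric] g_def l[symmetric] .
qed

lemma pcompose_monom: "pcompose (monom 1 n) q = q ^ n" for q :: "int poly"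
  by (induction n) (simp_all add: monom_0 monom_Suc pcompose_pCons)

lemma euler_functional_shift:
  "euler_functional (pcompose p [:1, 1:]) + euler_functional (pcompose p [:-1, 1:]) = 2 * poly p 0"
proof -
  have "euler_functional (pcompose p [:c, 1:]) =
      (\<Sum>i\<le>degree p. coeff p i * euler_functional ([:c, 1:] ^ i))" for c
  proof -
    have "pcompose p [:c, 1:] = pcompose (\<Sum>i\<le>degree p. monom (coeff p i) i) [:c, 1:]"
      by (simp add: poly_as_sum_of_monoms)
    also have "\<dots> = (\<Sum>i\<le>degree p. pcompose (smult (coeff p i) (monom 1 i)) [:c, 1:])"
      by (simp add: pcompose_sum smult_monom)
    also have "\<dots> = (\<Sum>i\<le>degree p. smult (coeff p i) ([:c, 1:] ^ i))"
      by (simp add: pcompose_smult pcompose_monom del: smult_monom)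
    finally show ?thesis
      by (simp add: euler_functional_sum euler_functional_smult)
  qed
  then have "euler_functional (pcompose p [:1, 1:]) + euler_functional (pcompose p [:-1, 1:]) =
      (\<Sum>i\<le>degree p. coeff p i *
        (euler_functional ([:1, 1:] ^ i) + euler_functional ([:-1, 1:] ^ i)))"
    by (simp add: sum.distrib distrib_left)
  also have "\<dots> = (\<Sum>i\<le>degree p. coeff p i * (if i = 0 then 2 else 0))"
    by (simp only: euler_functional_shift_power)
  also have "\<dots> = 2 * poly p 0"
    by (simp add: poly_0_coeff_0 if_distrib[of "\<lambda>x. _ * x"] cong: if_cong)
  finally show ?thesis .
qed

section \<open>Products over the odd nodes 1, 3, 5, ..\<close>

definition odd_falling :: "nat \<Rightarrow> int poly" where
  "odd_falling j = (\<Prod>i<j. [:- (2 * int i + 1), 1:])"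

lemma odd_falling_0 [simp]: "odd_falling 0 = 1"
  by (simp add: odd_falling_def)

lemma odd_falling_Suc: "odd_falling (Suc j) = odd_falling j * [:- (2 * int j + 1), 1:]"
  by (simp add: odd_falling_def)

text \<open>Apply the shift relation to \<open>P\<close> = x (x - 2) ... (x - 2 j), which vanishes
  at 0. Its two shifts are (x + 1) \<open>odd_falling j\<close> and
  \<open>odd_falling (Suc j)\<close>, and x + 1 = (x - (2 j + 1)) + 2 (j + 1) turns the relation
  into a recursion with factor -(j + 1).\<close>

lemma euler_functional_odd_falling: "euler_functional (odd_falling j) = (-1) ^ j * fact j"
proof (induction j)
  case 0
  then show ?case using euler_functional_monom[of 0] by (simp add: monom_0 one_pCons euler_number_0)
next
  case (Suc j)
  define P where "P = (\<Prod>i<Suc j. [:- (2 * int i), 1:])"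
  have plus: "pcompose P [:1, 1:] = [:1, 1:] * odd_falling j"
    unfolding P_def prod.lessThan_Suc_shift odd_falling_def
    by (simp add: pcompose_mult pcompose_prod pcompose_pCons algebra_simps)
  have minus: "pcompose P [:-1, 1:] = odd_falling (Suc j)"
    unfolding P_def odd_falling_def
    by (simp add: pcompose_prod pcompose_pCons algebra_simps del: prod.lessThan_Suc)
  have "[:1, 1:] * odd_falling j = odd_falling (Suc j) + smult (2 * (int j + 1)) (odd_falling j)"
  proof -
    have "[:1, 1:] * odd_falling j =
        ([:- (2 * int j + 1), 1:] + [:2 * (int j + 1):]) * odd_falling j" by simp
    then show ?thesis by (simp only: odd_falling_Suc distrib_right) (simp add: mult.commute)
  qed
  moreover have "poly P 0 = 0"
    by (simp add: P_def prod.lessThan_Suc_shift del: prod.lessThan_Suc)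
  ultimately have "2 * euler_functional (odd_falling (Suc j)) +
      2 * (int j + 1) * euler_functional (odd_falling j) = 0"
    using euler_functional_shift[of P] plus minus
    by (simp add: euler_functional_add euler_functional_smult)
  then have "2 * (euler_functional (odd_falling (Suc j)) +
      (int j + 1) * euler_functional (odd_falling j)) = 0"
    by (simp add: algebra_simps)
  then have "euler_functional (odd_falling (Suc j)) = - ((int j + 1) * euler_functional (odd_falling j))"
    by simp
  then show ?case using Suc by (simp add: algebra_simps)
qed

section \<open>Powers of 2 dividing the functional\<close>

text \<open>
  A lower bound for the exponent of \<open>2\<close> in \<open>n!\<close>, weak enough to grow by at most \<open>2\<close> over two steps.
\<close>
definition halves :: "nat \<Rightarrow> nat" where
  "halves n = n div 2 + n div 4"

lemma halves_add_2_le: "halves (n + 2) \<le> 2 + halves n"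
proof -
  have "(n + 2) div 4 \<le> (n + 4) div 4" by (rule div_le_mono) simp
  then show ?thesis by (simp add: halves_def)
qed

lemma halves_mono: "m \<le> n \<Longrightarrow> halves m \<le> halves n"
  by (simp add: halves_def add_mono div_le_mono)

text \<open>Induction in steps of 4: \<open>fact j\<close> contains the factor
  \<open>fact 4\<close>, which supplies the three twos by which \<open>halves\<close> grows.\<close>

lemma pow2_dvd_fact: "2 ^ halves j dvd (fact j :: nat)"
proof (induction j rule: less_induct)
  case (less j)
  show ?case
  proof (cases "j < 4")
    case True
    then consider "j = 0" | "j = 1" | "j = 2" | "j = 3" by linarith
    then show ?thesis by cases (simp_all add: fact_numeral halves_def)
  next
    case False
    then obtain i where i: "j = 4 + i" by (metis le_Suc_ex not_less)
    have "fact j = fact 4 * fact i * (j choose 4)"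
      using binomial_fact_lemma[of 4 j] i by simp
    moreover have "2 ^ 3 dvd (fact 4 :: nat)" by (simp add: fact_numeral)
    moreover have "2 ^ halves i dvd (fact i :: nat)" using less.IH[of i] i by simp
    moreover have "halves j = 3 + halves i" using i by (simp add: halves_def)
    ultimately show ?thesis by (simp only: power_add) (intro dvd_mult2 mult_dvd_mono)
  qed
qed

text \<open>Newton expansion of x^2 - 1 at the nodes 2 j + 1 and 2 j + 3. The factor 4 in the two
  lower terms makes up for their smaller index in the next induction.\<close>

lemma mult_odd_falling:
  "[:-1, 0, 1:] * odd_falling j = odd_falling (j + 2) + smult (4 * (int j + 1)) (odd_falling (j + 1))
     + smult (4 * (int j * (int j + 1))) (odd_falling j)"
proof -
  define a where "a = [:- (2 * int j + 1), 1:]"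
  define b where "b = [:- (2 * int j + 3), 1:]"
  have ident: "[:-1, 0, 1:] = a * b + smult (4 * (int j + 1)) a + [:4 * (int j * (int j + 1)):]"
    by (simp add: a_def b_def algebra_simps)
  have "odd_falling (j + 1) = odd_falling j * a" "odd_falling (j + 2) = odd_falling j * a * b"
    by (simp_all add: odd_falling_Suc a_def b_def numeral_2_eq_2 algebra_simps)
  then show ?thesis
    by (simp only: ident distrib_right) (simp add: mult_ac)
qed

text \<open>Multiplying by x^2 - 1 leads to the indices \<open>j + 2\<close>, \<open>j + 1\<close>
  and \<open>j\<close>, hence the induction for all \<open>j\<close> at once. The first term has the
  required exponent; the others fall short by at most 2, which their factor 4 covers.\<close>

lemma pow2_dvd_euler_functional:
  "2 ^ halves (2 * t + j) dvd euler_functional ([:-1, 0, 1:] ^ t * odd_falling j)"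
proof (induction t arbitrary: j)
  case 0
  have "2 ^ halves j dvd int (fact j)" using pow2_dvd_fact[of j] by (metis of_nat_dvd_iff of_nat_numeral of_nat_power)
  then show ?case by (simp add: euler_functional_odd_falling)
next
  case (Suc t)
  let ?V = "\<lambda>j. euler_functional ([:-1, 0, 1:] ^ t * odd_falling j)"
  let ?n = "halves (2 * Suc t + j)"
  have "[:-1, 0, 1:] ^ Suc t * odd_falling j = [:-1, 0, 1:] ^ t * ([:-1, 0, 1:] * odd_falling j)"
    by (simp only: power_Suc mult_ac)
  then have "euler_functional ([:-1, 0, 1:] ^ Suc t * odd_falling j) =
      ?V (j + 2) + 4 * (int j + 1) * ?V (j + 1) + 4 * (int j * (int j + 1)) * ?V j"
    by (simp only: mult_odd_falling distrib_left euler_functional_add mult_smult_right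
        euler_functional_smult)
  moreover have "2 ^ ?n dvd ?V (j + 2)"
    using Suc[of "j + 2"] by (simp add: add.commute)
  moreover have "2 ^ ?n dvd 4 * (int j + 1) * ?V (j + 1)"
  proof -
    have "(2 :: int) ^ 2 dvd 4 * (int j + 1)" by simp
    then have "2 ^ (2 + halves (2 * t + (j + 1))) dvd 4 * (int j + 1) * ?V (j + 1)"
      unfolding power_add[of 2 2] using Suc[of "j + 1"] by (rule mult_dvd_mono)
    moreover have "?n \<le> 2 + halves (2 * t + (j + 1))"
      using halves_add_2_le[of "2 * t + j"] halves_mono[of "2 * t + j" "2 * t + (j + 1)"] by simp
    ultimately show ?thesis by (metis power_le_dvd)
  qed
  moreover have "2 ^ ?n dvd 4 * (int j * (int j + 1)) * ?V j"
  proof -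
    have "(2 :: int) ^ 2 dvd 4 * (int j * (int j + 1))" by simp
    then have "2 ^ (2 + halves (2 * t + j)) dvd 4 * (int j * (int j + 1)) * ?V j"
      unfolding power_add[of 2 2] using Suc[of j] by (rule mult_dvd_mono)
    moreover have "?n \<le> 2 + halves (2 * t + j)"
      using halves_add_2_le[of "2 * t + j"] by simp
    ultimately show ?thesis by (metis power_le_dvd)
  qed
  ultimately show ?case by (metis dvd_add)
qed

section \<open>Differences of the even-indexed Euler numbers\<close>

definition euler_diff :: "nat \<Rightarrow> int" where
  "euler_diff t = euler_functional ([:-1, 0, 1:] ^ t)"

text \<open>Binomial theorem for x^(2 n) = ((x^2 - 1) + 1)^n. The free limit \<open>M\<close> allows
  a common range for two indices.\<close>

lemma euler_number_eq_sum_euler_diff: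
  assumes "n \<le> M"
  shows "euler_number (2 * n) = (\<Sum>t\<le>M. int (n choose t) * euler_diff t)"
proof -
  have "(monom 1 (2 * n) :: int poly) = (monom 1 2) ^ n"
    by (simp add: monom_power mult.commute)
  also have "monom 1 2 = [:-1, 0, 1:] + (1 :: int poly)"
    by (simp add: monom_altdef numeral_2_eq_2 one_pCons)
  also have "\<dots> ^ n = (\<Sum>t\<le>n. smult (int (n choose t)) ([:-1, 0, 1:] ^ t))"
    by (simp add: binomial_ring of_nat_poly)
  finally have "euler_number (2 * n) = (\<Sum>t\<le>n. int (n choose t) * euler_diff t)"
    by (metis (no_types, lifting) euler_functional_monom euler_functional_sum sum.cong
        euler_functional_smult euler_diff_def)
  also have "\<dots> = (\<Sum>t\<le>M. int (n choose t) * euler_diff t)"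
    using assms by (intro sum.mono_neutral_left) auto
  finally show ?thesis .
qed

lemma euler_number_values:
  "euler_number 2 = -1" "euler_number 4 = 5" "euler_number 6 = -61" "euler_number 8 = 1385"
  "euler_number 10 = -50521" "euler_number 12 = 2702765"
proof -
  note eval = euler_number_0 lessThan_nat_numeral lessThan_Suc binomial_fact' fact_numeral
  show 2: "euler_number 2 = -1"
    by (subst euler_number.simps) (simp add: eval)
  show 4: "euler_number 4 = 5"
    by (subst euler_number.simps) (simp add: eval 2)
  show 6: "euler_number 6 = -61"
    by (subst euler_number.simps) (simp add: eval 2 4)
  show 8: "euler_number 8 = 1385"
    by (subst euler_number.simps) (simp add: eval 2 4 6)
  show 10: "euler_number 10 = -50521"
    by (subst euler_number.simps) (simp add: eval 2 4 6 8)
  show "euler_number 12 = 2702765"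
    by (subst euler_number.simps) (simp add: eval 2 4 6 8 10)
qed

text \<open>
  \<open>euler_diff 6\<close> needs its actual value: the general bound yields only \<open>2\<^sup>9\<close>, one factor short.
\<close>
lemma euler_diff_values:
  "euler_diff 0 = 1" "euler_diff (Suc 0) = -2" "euler_diff 2 = 8" "euler_diff 3 = -80"
  "euler_diff 4 = 1664" "euler_diff 5 = -58112" "2 ^ 10 dvd euler_diff 6"
proof -
  note eval = euler_number_0 euler_number_values atMost_nat_numeral atMost_Suc binomial_fact' fact_numeral
  note sum = euler_number_eq_sum_euler_diff[OF order_refl]
  show 0: "euler_diff 0 = 1" using sum[of 0] by (simp add: eval)
  show 1: "euler_diff (Suc 0) = -2" using sum[of 1] by (simp add: eval 0)
  show 2: "euler_diff 2 = 8" using sum[of 2] by (simp add: eval 0 1)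
  show 3: "euler_diff 3 = -80" using sum[of 3] by (simp add: eval 0 1 2)
  show 4: "euler_diff 4 = 1664" using sum[of 4] by (simp add: eval 0 1 2 3)
  show 5: "euler_diff 5 = -58112" using sum[of 5] by (simp add: eval 0 1 2 3 4)
  have "euler_diff 6 = 3027968" using sum[of 6] by (simp add: eval 0 1 2 3 4 5)
  then show "2 ^ 10 dvd euler_diff 6" by simp
qed

lemma pow2_dvd_euler_diff: "2 ^ halves (2 * t) dvd euler_diff t"
  using pow2_dvd_euler_functional[of t 0] by (simp add: euler_diff_def)

section \<open>Differences of binomial coefficients and the tail of the expansion\<close>

text \<open>The odd part of \<open>r\<close> can be cancelled, and its power of 2 is at most
  \<open>2 ^ e\<close>.\<close>

lemma pow2_dvd_of_dvd_mult:
  fixes c r :: nat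
  assumes "2 ^ a dvd r * c" "0 < r" "r < 2 ^ Suc e"
  shows "2 ^ a dvd 2 ^ e * c"
proof -
  obtain q where r: "r = 2 ^ multiplicity 2 r * q" and q: "\<not> 2 dvd q"
    using multiplicity_decompose'[of r 2] assms(2) by auto
  let ?f = "multiplicity 2 r"
  have "2 ^ ?f \<le> r" using assms(2) by (intro dvd_imp_le multiplicity_dvd) auto
  then have "(2::nat) ^ ?f < 2 ^ Suc e" using assms(3) by linarith
  then have f: "?f \<le> e" by (simp only: power_strict_increasing_iff[of 2] less_Suc_eq_le)
  have "2 ^ a dvd 2 ^ ?f * c * q" using assms(1) r by (metis mult.assoc mult.commute)
  moreover have "coprime (2 ^ a) q" using q by (simp add: coprime_commute)
  ultimately have "2 ^ a dvd 2 ^ ?f * c" by (simp add: coprime_dvd_mult_left_iff)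
  moreover have "2 ^ ?f * c dvd 2 ^ e * c" using f by (intro mult_dvd_mono le_imp_power_dvd) auto
  ultimately show ?thesis by (rule dvd_trans)
qed

text \<open>By Vandermonde only the terms with \<open>r \<ge> 1\<close> remain. Since
  \<open>r * (K choose r)\<close> is a multiple of \<open>K\<close>, the power of 2 lost in
  \<open>K choose r\<close> is at most \<open>2 ^ e\<close>.\<close>

lemma pow2_dvd_binomial_diff:
  assumes "2 ^ a dvd K" "t < 2 ^ Suc e"
  shows "2 ^ a dvd (2 :: int) ^ e * (int ((N + K) choose t) - int (N choose t))"
proof -
  have "2 ^ a dvd 2 ^ e * (K choose r)" if "0 < r" "r \<le> t" for r
  proof (rule pow2_dvd_of_dvd_mult)
    show "2 ^ a dvd r * (K choose r)"
      using assms(1) that(1) by (simp add: times_binomial_minus1_eq)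
  qed (use that assms(2) in auto)
  then have "int (2 ^ a) dvd int (2 ^ e * (K choose r))" if "0 < r" "r \<le> t" for r
    using that by (simp only: of_nat_dvd_iff)
  then have *: "2 ^ a dvd (2::int) ^ e * int (K choose r)" if "0 < r" "r \<le> t" for r
    using that by simp
  have "(N + K) choose t = (\<Sum>r\<le>t. (K choose r) * (N choose (t - r)))"
    by (simp add: vandermonde add.commute)
  also have "{..t} = insert 0 {1..t}" by auto
  finally have "int ((N + K) choose t) - int (N choose t) =
      (\<Sum>r=1..t. int (K choose r) * int (N choose (t - r)))"
    by simp
  then have "(2::int) ^ e * (int ((N + K) choose t) - int (N choose t)) =
      (\<Sum>r=1..t. 2 ^ e * int (K choose r) * int (N choose (t - r)))"
    by (simp add: sum_distrib_left mult.assoc)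
  then show ?thesis by (simp only:) (intro dvd_sum dvd_mult2 *, auto)
qed

text \<open>The binomial difference loses at most \<open>2 ^ e\<close>, where
  \<open>2 ^ e \<le> t < 2 ^ Suc e\<close>, so it suffices that \<open>2 ^ (8 + e)\<close> divides
  \<open>euler_diff t\<close>.\<close>

lemma pow2_dvd_euler_diff_binomial:
  assumes "2 ^ a dvd K" "6 \<le> t"
  shows "2 ^ (a + 8) dvd euler_diff t * (int ((N + K) choose t) - int (N choose t))"
proof -
  obtain e where e: "2 ^ e \<le> t" "t < 2 ^ Suc e"
    using ex_power_ivl1[of 2 t] assms(2) by auto
  have "2 ^ (8 + e) dvd euler_diff t"
  proof -
    consider "t = 6" | "t = 7" | "8 \<le> t" using assms(2) by linarith
    then show ?thesis
    proof cases
      case 1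
      then have "(2::nat) ^ e < 2 ^ 3" using e by simp
      then have "8 + e \<le> 10" by (subst (asm) power_strict_increasing_iff) auto
      then show ?thesis using euler_diff_values(7) 1 by (metis power_le_dvd)
    next
      case 2
      then have "(2::nat) ^ e < 2 ^ 3" using e by simp
      then have "8 + e \<le> halves (2 * t)" using 2 by (subst (asm) power_strict_increasing_iff) (auto simp: halves_def)
      then show ?thesis using pow2_dvd_euler_diff[of t] by (metis power_le_dvd)
    next
      case 3
      then have "(2::nat) ^ 3 < 2 ^ Suc e" using e by simp
      then have "3 \<le> e" by (subst (asm) power_strict_increasing_iff) auto
      then obtain d where d: "e = 3 + d" using le_Suc_ex by blast
      \<comment> \<open>The two sides are \<open>8 + e\<close> and \<open>halves (2 * 2 ^ e)\<close>
        for \<open>e = 3 + d\<close>.\<close>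
      have "11 + d \<le> 12 * 2 ^ d" using less_exp[of d] by linarith
      then have "8 + e \<le> halves (2 * 2 ^ e)" unfolding d halves_def power_add by simp
      also have "\<dots> \<le> halves (2 * t)" using e by (intro halves_mono) simp
      finally show ?thesis using pow2_dvd_euler_diff[of t] by (metis power_le_dvd)
    qed
  qed
  then obtain c where "euler_diff t = 2 ^ 8 * 2 ^ e * c" by (auto simp: power_add)
  then have "euler_diff t * (int ((N + K) choose t) - int (N choose t)) =
      2 ^ 8 * (2 ^ e * (int ((N + K) choose t) - int (N choose t))) * c"
    by simp
  then show ?thesis
    unfolding power_add using pow2_dvd_binomial_diff[OF assms(1) e(2), of N]
    by (metis dvd_mult2 dvd_refl mult.commute mult_dvd_mono)
qed

section \<open>Reduction to a polynomial slope\<close>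

definition falling :: "nat \<Rightarrow> int \<Rightarrow> int" where
  "falling t x = (\<Prod>i<t. x - int i)"

lemma falling_of_nat: "falling t (int n) = fact t * int (n choose t)"
proof -
  have "real_of_int (falling t (int n)) = real_of_int (fact t * int (n choose t))"
    by (simp add: falling_def binomial_gbinomial gbinomial_prod_rev lessThan_atLeast0)
  then show ?thesis by (simp only: of_int_eq_iff)
qed

text \<open>The divided difference of \<open>falling t\<close> between \<open>x\<close> and
  \<open>x + d\<close>, built by the product rule so that no division occurs.\<close>

fun falling_slope :: "nat \<Rightarrow> int \<Rightarrow> int \<Rightarrow> int" where
  "falling_slope 0 x d = 0"
| "falling_slope (Suc t) x d = falling_slope t x d * (x + d - int t) + falling t x"

lemma falling_diff: "falling t (x + d) - falling t x = d * falling_slope t x d"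
proof (induction t)
  case (Suc t)
  have "falling (Suc t) (x + d) - falling (Suc t) x =
      (falling t (x + d) - falling t x) * (x + d - int t) + falling t x * d"
    by (simp add: falling_def algebra_simps)
  then show ?case by (simp only: Suc falling_slope.simps) (simp add: algebra_simps)
qed (simp add: falling_def)

text \<open>
  The coefficients are those of \<open>D t / t!\<close> reduced modulo \<open>2\<^sup>8\<close>; the odd denominators (\<open>3\<close> and \<open>15\<close>)
  are inverted there.
\<close>
definition euler_slope :: "int \<Rightarrow> int \<Rightarrow> int" where
  "euler_slope x d = - 2 + 4 * falling_slope 2 x d + 72 * falling_slope 3 x d
     - 16 * falling_slope 4 x d + 96 * falling_slope 5 x d"

text \<open>The terms with \<open>t \<ge> 6\<close> vanish modulo \<open>2 ^ (a + 8)\<close>. The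
  others are \<open>K\<close> times slopes with denominators dividing 15 after reduction, and 15 is
  invertible modulo powers of 2.\<close>

lemma euler_number_diff_cong_slope:
  assumes "2 ^ a dvd K"
  shows "[euler_number (2 * (N + K)) - euler_number (2 * N) =
    int K * euler_slope (int N) (int K)] (mod 2 ^ (a + 8))"
proof -
  define \<Delta> where "\<Delta> t = int ((N + K) choose t) - int (N choose t)" for t
  define X where "X = (\<Sum>t<6. euler_diff t * \<Delta> t)"
  define Y where "Y = int K * euler_slope (int N) (int K)"
  let ?q = "\<lambda>t. falling_slope t (int N) (int K)"
  \<comment> \<open>The common limit \<open>N + K + 6\<close> covers both indices and makes every
    \<open>t < 6\<close> occur.\<close>
  have "euler_number (2 * (N + K)) - euler_number (2 * N) =
      (\<Sum>t\<le>N + K + 6. euler_diff t * \<Delta> t)"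
    by (subst (1 2) euler_number_eq_sum_euler_diff[of _ "N + K + 6"])
      (simp_all add: \<Delta>_def right_diff_distrib mult.commute sum_subtractf)
  also have "{..N + K + 6} = {..<6} \<union> {6..N + K + 6}" by auto
  also have "(\<Sum>t\<in>{..<6} \<union> {6..N + K + 6}. euler_diff t * \<Delta> t) =
      X + (\<Sum>t=6..N + K + 6. euler_diff t * \<Delta> t)"
    unfolding X_def by (intro sum.union_disjoint) auto
  finally have tail: "euler_number (2 * (N + K)) - euler_number (2 * N) - X =
      (\<Sum>t=6..N + K + 6. euler_diff t * \<Delta> t)" by simp
  have "2 ^ (a + 8) dvd (\<Sum>t=6..N + K + 6. euler_diff t * \<Delta> t)"
    unfolding \<Delta>_def using assms by (intro dvd_sum pow2_dvd_euler_diff_binomial) auto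
  with tail have X_cong: "[euler_number (2 * (N + K)) - euler_number (2 * N) = X] (mod 2 ^ (a + 8))"
    by (simp add: cong_iff_dvd_diff)
  have X: "X = - 2 * \<Delta> (Suc 0) + 8 * \<Delta> 2 - 80 * \<Delta> 3 + 1664 * \<Delta> 4 - 58112 * \<Delta> 5"
    by (simp add: X_def lessThan_nat_numeral lessThan_Suc euler_diff_values \<Delta>_def)
  have q: "int K * ?q t = fact t * \<Delta> t" for t
    using falling_diff[of t "int N" "int K"]
    by (simp only: \<Delta>_def falling_of_nat right_diff_distrib flip: of_nat_add)
  have "\<Delta> (Suc 0) = int K" by (simp add: \<Delta>_def)
  \<comment> \<open>For t = 3, 4, 5 the quotients \<open>euler_diff t / fact t\<close> are -40/3,
    208/3 and -7264/15. Subtracting 72, -16 and 96 and multiplying by 15 gives 256 times -5, 5 and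
    -34.\<close>
  then have "15 * (X - Y) = int K * (- 5 * ?q 3 + 5 * ?q 4 - 34 * ?q 5) * 256"
    using X q[of 2] q[of 3] q[of 4] q[of 5]
    by (simp add: Y_def euler_slope_def fact_numeral algebra_simps)
  moreover have "2 ^ a dvd int K" using assms by (metis of_nat_dvd_iff of_nat_numeral of_nat_power)
  then have "2 ^ a * 2 ^ 8 dvd int K * (- 5 * ?q 3 + 5 * ?q 4 - 34 * ?q 5) * 256"
    by (intro mult_dvd_mono dvd_mult2) auto
  ultimately have "2 ^ (a + 8) dvd 15 * (X - Y)"
    by (simp only: power_add)
  moreover have "coprime (2 ^ (a + 8)) (15 :: int)" by simp
  ultimately have "[X = Y] (mod 2 ^ (a + 8))"
    unfolding cong_iff_dvd_diff using coprime_dvd_mult_right_iff by blast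
  with X_cong show ?thesis unfolding Y_def by (rule cong_trans)
qed

text \<open>The factor \<open>K\<close> already supplies \<open>2 ^ a\<close>, so the slope matters
  only modulo 256.\<close>

lemma euler_number_diff_cong:
  assumes "2 ^ a dvd K" "256 dvd euler_slope (int N) (int K) - c"
  shows "[euler_number (2 * (N + K)) - euler_number (2 * N) = int K * c] (mod 2 ^ (a + 8))"
proof -
  have "(2::int) ^ a dvd int K" using assms(1) by (metis of_nat_dvd_iff of_nat_numeral of_nat_power)
  then have "2 ^ a * 2 ^ 8 dvd int K * (euler_slope (int N) (int K) - c)"
    using assms(2) by (intro mult_dvd_mono) simp_all
  then have "[int K * euler_slope (int N) (int K) = int K * c] (mod 2 ^ (a + 8))"
    by (simp only: cong_iff_dvd_diff power_add right_diff_distrib)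
  with euler_number_diff_cong_slope[OF assms(1)] show ?thesis by (rule cong_trans)
qed

section \<open>Closed forms of the slope modulo 256\<close>

lemma falling_slope_numeral:
  "falling_slope 2 x d = d + 2 * x - 1"
  "falling_slope 3 x d = falling_slope 2 x d * (x + d - 2) + x * (x - 1)"
  "falling_slope 4 x d = falling_slope 3 x d * (x + d - 3) + x * (x - 1) * (x - 2)"
  "falling_slope 5 x d = falling_slope 4 x d * (x + d - 4) + x * (x - 1) * (x - 2) * (x - 3)"
  by (simp_all add: eval_nat_numeral falling_def algebra_simps)

lemmas euler_slope_expand = euler_slope_def falling_slope_numeral power2_eq_square algebra_simps

text \<open>
  In the congruences modulo \<open>256\<close> below, once \<open>int N\<close> and \<open>d\<close> are written as \<open>2 u\<close> or \<open>2 u + 1\<close> all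
  coefficients vanish modulo \<open>128\<close>, and those that do not vanish modulo \<open>256\<close> form \<open>128\<close> times an even
  polynomial \<open>p\<close>.
\<close>
lemma dvd_256I:
  fixes x p :: int
  assumes "256 dvd x - 128 * p" "even p"
  shows "256 dvd x"
proof -
  have "256 dvd 128 * p" using assms(2) by auto
  with assms(1) show ?thesis by (metis dvd_add diff_add_cancel)
qed

lemma minus_one_power_parity:
  obtains u where "int N = 2 * int u \<and> (-1) ^ N = (1::int) \<or>
    int N = 2 * int u + 1 \<and> (-1) ^ N = (-1::int)"
proof (cases "even N")
  case True
  then show ?thesis using that[of "N div 2"] by auto
next
  case False
  then show ?thesis using that[of "N div 2"] by (auto elim!: oddE)
qed

lemma euler_slope_four:
  "256 dvd euler_slope (int N) (4 * v) - 2 * (7 * (2 * int N + 1)\<^sup>2 - 18 + 8 * v * (7 - 2 * int N))"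
proof -
  obtain u where "int N = 2 * int u \<or> int N = 2 * int u + 1"
    by (metis evenE oddE of_nat_add of_nat_mult of_nat_numeral of_nat_1)
  then have "256 dvd euler_slope (int N) (4 * v)
      - 2 * (7 * (2 * int N + 1)\<^sup>2 - 18 + 8 * v * (7 - 2 * int N))
      - 128 * (int u * (int u + 1) + v * (v + 1))"
    by (elim disjE) (simp_all add: euler_slope_expand)
  then show ?thesis by (rule dvd_256I) simp
qed

lemma euler_slope_two:
  "256 dvd euler_slope (int N) (2 * v) - 2 * (7 * (2 * int N + 1)\<^sup>2 - 18
     + 12 * v * (2 * int N + 1 + 4 * ((-1) ^ N - v)))"
proof -
  obtain u where "int N = 2 * int u \<and> (-1) ^ N = (1::int) \<or>
      int N = 2 * int u + 1 \<and> (-1) ^ N = (-1::int)"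
    by (rule minus_one_power_parity)
  then have "256 dvd euler_slope (int N) (2 * v)
      - 2 * (7 * (2 * int N + 1)\<^sup>2 - 18 + 12 * v * (2 * int N + 1 + 4 * ((-1) ^ N - v)))
      - 128 * (int u * (int u + 1) + v * (v + 1) * v)"
    by (elim disjE conjE) (simp_all add: euler_slope_expand)
  then show ?thesis by (rule dvd_256I) simp
qed

lemma euler_slope_even:
  assumes "even d"
  shows "256 dvd d * euler_slope (int N) d
    - 2 * d * (- ((2 * int N - 7)\<^sup>2) + 38 + 2 * d * (6 * int N - 1 + 2 * d))"
proof -
  obtain v where v: "d = 2 * v" using assms by (elim evenE)
  obtain u where "int N = 2 * int u \<or> int N = 2 * int u + 1"
    by (metis evenE oddE of_nat_add of_nat_mult of_nat_numeral of_nat_1)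
  \<comment> \<open>\<open>int N - 2 * int u\<close> is the parity of \<open>N\<close>, so one
    correction polynomial serves both parities.\<close>
  then have "256 dvd d * euler_slope (int N) d
      - 2 * d * (- ((2 * int N - 7)\<^sup>2) + 38 + 2 * d * (6 * int N - 1 + 2 * d))
      - 128 * ((int N - 2 * int u) * (v * (v + 1)))"
    by (elim disjE) (simp_all add: v euler_slope_expand)
  then show ?thesis by (rule dvd_256I) simp
qed

text \<open>The term \<open>16 * (2 * int N + (-1) ^ N)\<close> carries no factor \<open>d\<close>,
  so the product \<open>d * euler_slope (int N) d\<close> is compared rather than the slope.\<close>

lemma euler_slope_odd:
  assumes "odd d"
  shows "256 dvd d * euler_slope (int N) d
    - (2 * d * (- ((2 * int N + 1)\<^sup>2) + 6 + 2 * d * (6 * int N - 1 + 2 * d))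
        - 16 * (2 * int N + (-1) ^ N))"
proof -
  obtain v where v: "d = 2 * v + 1" using assms by (elim oddE)
  obtain u where "int N = 2 * int u \<and> (-1) ^ N = (1::int) \<or>
      int N = 2 * int u + 1 \<and> (-1) ^ N = (-1::int)"
    by (rule minus_one_power_parity)
  then have "256 dvd d * euler_slope (int N) d
      - (2 * d * (- ((2 * int N + 1)\<^sup>2) + 6 + 2 * d * (6 * int N - 1 + 2 * d))
        - 16 * (2 * int N + (-1) ^ N))
      - 128 * ((1 - (int N - 2 * int u)) * (v * (v + 1)))"
    by (elim disjE conjE) (simp_all add: v euler_slope_expand)
  then show ?thesis by (rule dvd_256I) simp
qed

text \<open>With \<open>b = 2 * N\<close> the index grows by 2 K for K = 2^(m - 1) k. Taking
  \<open>a = m - 1\<close> gives the modulus \<open>2 ^ (m + 7)\<close>, and the cases differ only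
  in the closed form of the slope at K.\<close>

theorem theorem2p1:
  fixes b k m :: nat
  assumes "even b" and "k \<ge> 1" and "m \<ge> 1"
  shows "[euler_number (2 ^ m * k + b) - euler_number b =
     (if m = 1 \<and> even k then
        2 * int k * (- ((int b - 7)\<^sup>2) + 38 + 2 * int k * (3 * int b - 1 + 2 * int k))
      else if m = 1 \<and> odd k then
        2 * int k * (- ((int b + 1)\<^sup>2) + 6 + 2 * int k * (3 * int b - 1 + 2 * int k))
          - 16 * (int b + (-1) ^ (b div 2))
      else if m = 2 then
        4 * int k * (7 * (int b + 1)\<^sup>2 - 18
          + 12 * int k * (int b + 1 + 4 * ((-1) ^ (b div 2) - int k)))
      else
        2 ^ m * int k * (7 * (int b + 1)\<^sup>2 - 18 + 2 ^ m * int k * (7 - int b)))]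
     (mod 2 ^ (m + 7))"
proof -
  obtain N where b: "b = 2 * N" using \<open>even b\<close> by (elim evenE)
  consider "m = 1" "even k" | "m = 1" "odd k" | "m = 2" | n where "m = n + 3"
  proof (cases "m < 3")
    case True
    then have "m = 1 \<or> m = 2" using \<open>m \<ge> 1\<close> by linarith
    then show ?thesis using that(1-3) by blast
  next
    case False
    then show ?thesis using that(4)[of "m - 3"] by simp
  qed
  then show ?thesis
  proof cases
    case 1
    have "[euler_number (2 * (N + k)) - euler_number (2 * N) =
        int k * euler_slope (int N) (int k)] (mod 2 ^ 8)"
      using euler_number_diff_cong_slope[of 0 k N] by simp
    also have "[int k * euler_slope (int N) (int k) = 2 * int k * (- ((2 * int N - 7)\<^sup>2) + 38
        + 2 * int k * (6 * int N - 1 + 2 * int k))] (mod 2 ^ 8)"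
      using euler_slope_even[of "int k" N] 1 by (simp add: cong_iff_dvd_diff)
    finally show ?thesis using 1 by (simp add: b add.commute)
  next
    case 2
    have "[euler_number (2 * (N + k)) - euler_number (2 * N) =
        int k * euler_slope (int N) (int k)] (mod 2 ^ 8)"
      using euler_number_diff_cong_slope[of 0 k N] by simp
    also have "[int k * euler_slope (int N) (int k) = 2 * int k * (- ((2 * int N + 1)\<^sup>2) + 6
        + 2 * int k * (6 * int N - 1 + 2 * int k)) - 16 * (2 * int N + (-1) ^ N)] (mod 2 ^ 8)"
      using euler_slope_odd[of "int k" N] 2 by (simp add: cong_iff_dvd_diff)
    finally show ?thesis using 2 by (simp add: b add.commute)
  next
    case 3
    let ?A = "7 * (2 * int N + 1)\<^sup>2 - 18 + 12 * int k * (2 * int N + 1 + 4 * ((-1) ^ N - int k))"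
    have "[euler_number (2 * (N + 2 * k)) - euler_number (2 * N) = int (2 * k) * (2 * ?A)]
        (mod 2 ^ (1 + 8))"
    proof (rule euler_number_diff_cong)
      show "256 dvd euler_slope (int N) (int (2 * k)) - 2 * ?A"
        using euler_slope_two[of N "int k"] by (simp only: of_nat_mult of_nat_numeral)
    qed simp
    moreover have "2 * (N + 2 * k) = 2 ^ m * k + b" using 3 b by simp
    moreover have "int (2 * k) * (2 * ?A) = 4 * int k * ?A" by simp
    ultimately have "[euler_number (2 ^ m * k + b) - euler_number (2 * N) = 4 * int k * ?A]
        (mod 2 ^ (1 + 8))"
      by (simp only:)
    then show ?thesis using 3 by (simp add: b)
  next
    case 4
    let ?K = "4 * (2 ^ n * k)"
    let ?A = "7 * (2 * int N + 1)\<^sup>2 - 18 + 8 * (2 ^ n * int k) * (7 - 2 * int N)"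
    have "[euler_number (2 * (N + ?K)) - euler_number (2 * N) = int ?K * (2 * ?A)]
        (mod 2 ^ (n + 2 + 8))"
    proof (rule euler_number_diff_cong)
      show "2 ^ (n + 2) dvd ?K" by (simp add: power_add)
      show "256 dvd euler_slope (int N) (int ?K) - 2 * ?A"
        using euler_slope_four[of N "2 ^ n * int k"]
        by (simp only: of_nat_mult of_nat_numeral of_nat_power)
    qed
    moreover have "(2::int) ^ m = 8 * 2 ^ n" using 4 by (simp add: power_add)
    then have "int ?K * (2 * ?A) =
        2 ^ m * int k * (7 * (int b + 1)\<^sup>2 - 18 + 2 ^ m * int k * (7 - int b))"
      by (simp add: b)
    moreover have "2 * (N + ?K) = 2 ^ m * k + b" "n + 2 + 8 = m + 7"
      using 4 b by (simp_all add: power_add)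
    ultimately have "[euler_number (2 ^ m * k + b) - euler_number (2 * N) =
        2 ^ m * int k * (7 * (int b + 1)\<^sup>2 - 18 + 2 ^ m * int k * (7 - int b))] (mod 2 ^ (m + 7))"
      by (simp only:)
    then show ?thesis using 4 by (simp add: b)
  qed
qed

end
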